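(* Let $K\subset\mathbb{R}$ be Borel-measurable, and let $(f_n)_{n\in\mathbb{N}}$ be a sequence of non-negative Borel-measurable functions $f_n:K\to\mathbb{R}$ such that $f_n\to f$ pointwise on $K$, where $f:K\to\mathbb{R}$. Then $$(\mathrm{H})\int_K f\ \leq\ \varliminf_{n\to\infty}\,(\mathrm{H})\int_K f_n .$$
   Context: The set $[0,1]\times[0,+\infty]$ carries the lexicographic order: $(d_1,m_1)\leq(d_2,m_2)$ iff $d_1<d_2$, or $d_1=d_2$ and $m_1\leq m_2$; it is equipped with the order topology of this order. Every subset of it has an infimum and a supremum in it. For a sequence $(h_n)$ in $[0,1]\times[0,+\infty]$, $\varliminf_{n\to\infty}h_n=\lim_{n\to\infty}\inf\{h_k:k\geq n\}$, where infima are taken and the limit is computed in $[0,1]\times[0,+\infty]$ with the order topology (the limit exists, since the sequence of infima is increasing). $\dim_{\mathrm{H}}$ denotes Hausdorff dimension and $\mu^d$ the $d$-dimensional Hausdorff measure on $\mathbb{R}$ (normalized so that $\mu^0$ is the counting measure and $\mu^1$ is the Lebesgue measure). Hausdorff-integral: for $K\subset\mathbb{R}$ Borel-measurable and $f:K\to\mathbb{R}$ Borel-measurable, let $D_f=\{x\in K: f(x)\neq 0\}$ and set $(\mathrm{H})\int_K f=(d,m)\in[0,1]\times[-\infty,+\infty]$, where $d=\dim_{\mathrm{H}}D_f$ and $m=\int_{D_f}f\,d\mu^d$, with the conventions $\dim_{\mathrm{H}}\emptyset=0$ and $\int_\emptyset f\,d\mu^d=0$. For $f\geq 0$ the Hausdorff-integral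 always exists and lies in $[0,1]\times[0,+\infty]$. *)

theory Defs
  imports "HOL-Analysis.Analysis"
begin

text \<open>
  The Hausdorff measures on the real line are built from the gauge $|U|^d$ without a
  dimensional constant, so that the cases $d = 0$ and $d = 1$ are the counting measure and
  the Lebesgue measure. For $d = 0$ a nonempty set counts 1 (\<^const>\<open>powr\<close> would give
  \<open>0 powr 0 = 0\<close> on singletons).
\<close>

definition hausdorff_gauge :: "real \<Rightarrow> real set \<Rightarrow> ennreal" where
  "hausdorff_gauge d U =
     (if U = {} then 0 else if d = 0 then 1 else ennreal (diameter U powr d))"

text \<open>
  Boundedness has to be demanded separately: \<^const>\<open>diameter\<close> has no meaningful value
  on unbounded sets.
\<close>

definition delta_covers :: "real \<Rightarrow> real set \<Rightarrow> (nat \<Rightarrow> real set) set" where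
  "delta_covers \<delta> A =
     {U. (\<forall>i. bounded (U i) \<and> diameter (U i) \<le> \<delta>) \<and> A \<subseteq> (\<Union>i. U i)}"

definition hausdorff_outer :: "real \<Rightarrow> real set \<Rightarrow> ennreal" where
  "hausdorff_outer d A =
     (SUP \<delta>\<in>{0<..}. INF U\<in>delta_covers \<delta> A. (\<Sum>i. hausdorff_gauge d (U i)))"

definition hausdorff_measure :: "real \<Rightarrow> real measure" where
  "hausdorff_measure d = measure_of UNIV (sets borel) (hausdorff_outer d)"

definition hausdorff_dim :: "real set \<Rightarrow> real" where
  "hausdorff_dim A = Inf {d. 0 \<le> d \<and> hausdorff_outer d A = 0}"

lemma hausdorff_outer_mono:
  assumes "A \<subseteq> B"
  shows "hausdorff_outer d A \<le> hausdorff_outer d B"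
  unfolding hausdorff_outer_def
proof (rule SUP_mono)
  fix \<delta> :: real assume "\<delta> \<in> {0<..}"
  have "delta_covers \<delta> B \<subseteq> delta_covers \<delta> A"
    using assms by (auto simp: delta_covers_def)
  then show "\<exists>\<delta>'\<in>{0<..}. (INF U\<in>delta_covers \<delta> A. \<Sum>i. hausdorff_gauge d (U i))
      \<le> (INF U\<in>delta_covers \<delta>' B. \<Sum>i. hausdorff_gauge d (U i))"
    using \<open>\<delta> \<in> {0<..}\<close> by (intro bexI[of _ \<delta>] INF_superset_mono) auto
qed

lemma hausdorff_outer_UNIV_eq_0:
  assumes d: "d > 1"
  shows "hausdorff_outer d UNIV = 0"
proof -
  define C where "C = (\<Sum>i. real (Suc i) powr (-d))"
  have summ: "summable (\<lambda>i. real (Suc i) powr (-d))"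
    using summable_Suc_iff[of "\<lambda>i. real i powr (-d)"] summable_real_powr_iff[of "-d"] d by simp
  have bound: "(INF U\<in>delta_covers \<delta> UNIV. \<Sum>i. hausdorff_gauge d (U i))
      \<le> ennreal ((2 * \<epsilon>) powr d * C)" if \<epsilon>: "0 < \<epsilon>" "\<epsilon> \<le> \<delta>" for \<epsilon> \<delta> :: real
  proof -
    define l where "l i = \<epsilon> / real (Suc i)" for i
    define s where "s n = (\<Sum>i<n. l i)" for n
    define U where "U i = (if even i then {s (i div 2)..s (Suc (i div 2))}
        else {- s (Suc (i div 2)).. - s (i div 2)})" for i
    have lpos: "l i > 0" for i using \<epsilon> by (simp add: l_def)
    have sS: "s (Suc k) = s k + l k" for k by (simp add: s_def)
    have diam: "diameter (U i) = l (i div 2)" for i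
      using lpos[of "i div 2"] by (auto simp: U_def sS diameter_closed_interval)
    have lle: "l (i div 2) \<le> 2 * \<epsilon> / real (Suc i)" for i
    proof -
      have "Suc i \<le> 2 * Suc (i div 2)" by presburger
      then have "real (Suc i) \<le> 2 * real (Suc (i div 2))" by linarith
      from mult_left_mono[OF this, of \<epsilon>] show ?thesis
        using \<epsilon>(1) by (simp add: l_def divide_simps mult_ac)
    qed
    have ld: "l i \<le> \<delta>" for i
      using frac_le[of \<epsilon> \<epsilon> 1 "real (Suc i)"] \<epsilon> by (simp add: l_def)
    have unb: "\<exists>n. x < s n" for x
    proof (rule ccontr)
      assume "\<not> ?thesis"
      then have "s (Suc n) \<le> x" for n by (simp add: not_less)
      then have "sum l {..n} \<le> x" for n by (simp only: s_def lessThan_Suc_atMost)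
      then have "summable l"
        using lpos by (intro bounded_imp_summable[of l x]) (auto simp: less_imp_le)
      then have "summable (\<lambda>i. inverse \<epsilon> * l i)" by (rule summable_mult)
      moreover have "(\<lambda>i. inverse \<epsilon> * l i) = (\<lambda>i. inverse (real (Suc i)))"
        using \<epsilon> by (auto simp: l_def field_simps)
      ultimately show False
        using not_summable_harmonic[where 'a = real]
          summable_Suc_iff[of "\<lambda>i. inverse (real i)"] by simp
    qed
    have pos: "\<exists>k. x \<in> {s k..s (Suc k)}" if x0: "x \<ge> 0" for x
    proof -
      define n where "n = (LEAST n. x < s n)"
      have n: "x < s n" unfolding n_def using unb by (metis LeastI_ex)
      then obtain k where k: "n = Suc k" using x0 by (cases n) (auto simp: s_def)
      have "\<not> x < s k" using not_less_Least[of k "\<lambda>n. x < s n"] k n_def by auto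
      then show ?thesis using n k by (intro exI[of _ k]) auto
    qed
    have cov: "x \<in> (\<Union>i. U i)" for x
    proof (cases "x \<ge> 0")
      case True
      then obtain k where "x \<in> {s k..s (Suc k)}" using pos by blast
      then have "x \<in> U (2 * k)" by (simp add: U_def)
      then show ?thesis by blast
    next
      case False
      then obtain k where "-x \<in> {s k..s (Suc k)}" using pos[of "-x"] by auto
      then have "x \<in> U (Suc (2 * k))" by (simp add: U_def)
      then show ?thesis by blast
    qed
    have "U \<in> delta_covers \<delta> UNIV"
      using cov ld by (auto simp: delta_covers_def diam) (simp add: U_def)
    then have "(INF U\<in>delta_covers \<delta> UNIV. \<Sum>i. hausdorff_gauge d (U i))
        \<le> (\<Sum>i. hausdorff_gauge d (U i))"
      by (rule INF_lower)
    also have "\<dots> \<le> ennreal ((2 * \<epsilon>) powr d * C)"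
    proof -
      have "hausdorff_gauge d (U i) \<le> ennreal ((2 * \<epsilon>) powr d * real (Suc i) powr (-d))" for i
      proof -
        have "l (i div 2) powr d \<le> (2 * \<epsilon> / real (Suc i)) powr d"
          using lle[of i] lpos[of "i div 2"] d by (intro powr_mono2) auto
        also have "\<dots> = (2 * \<epsilon>) powr d * real (Suc i) powr (-d)"
          using \<epsilon> powr_divide[of "2 * \<epsilon>" "real (Suc i)" d]
          by (simp add: powr_minus divide_inverse del: of_nat_Suc)
        finally show ?thesis
          using d by (auto simp: hausdorff_gauge_def diam intro: ennreal_leI)
      qed
      then have "(\<Sum>i. hausdorff_gauge d (U i))
          \<le> (\<Sum>i. ennreal ((2 * \<epsilon>) powr d * real (Suc i) powr (-d)))"
        by (intro suminf_le) auto
      also have "\<dots> = ennreal (\<Sum>i. (2 * \<epsilon>) powr d * real (Suc i) powr (-d))"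
        using summ by (intro suminf_ennreal2 summable_mult) auto
      also have "\<dots> = ennreal ((2 * \<epsilon>) powr d * C)"
        using suminf_mult[OF summ] by (simp add: C_def)
      finally show ?thesis .
    qed
    finally show ?thesis .
  qed
  have "(INF U\<in>delta_covers \<delta> UNIV. \<Sum>i. hausdorff_gauge d (U i)) \<le> 0" if \<delta>: "\<delta> > 0" for \<delta>
  proof (rule tendsto_lowerbound)
    have "((\<lambda>\<epsilon>. 2 * \<epsilon>) \<longlongrightarrow> 2 * (0 :: real)) (at_right 0)"
      by (intro tendsto_intros)
    moreover have "\<forall>\<^sub>F \<epsilon> in at_right (0 :: real). 0 \<le> 2 * \<epsilon>"
      using eventually_at_right_less[of 0] by eventually_elim simp
    ultimately have "((\<lambda>\<epsilon>. (2 * \<epsilon>) powr d) \<longlongrightarrow> (2 * 0) powr d) (at_right (0 :: real))"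
      using d by (intro tendsto_powr'[OF _ tendsto_const]) auto
    then have "((\<lambda>\<epsilon>. (2 * \<epsilon>) powr d * C) \<longlongrightarrow> (2 * 0) powr d * C) (at_right (0 :: real))"
      by (rule tendsto_mult_right)
    from tendsto_ennrealI[OF this]
    show "((\<lambda>\<epsilon>. ennreal ((2 * \<epsilon>) powr d * C)) \<longlongrightarrow> 0) (at_right 0)"
      by simp
    show "\<forall>\<^sub>F \<epsilon> in at_right 0. (INF U\<in>delta_covers \<delta> UNIV. \<Sum>i. hausdorff_gauge d (U i))
        \<le> ennreal ((2 * \<epsilon>) powr d * C)"
      using eventually_at_right_real[OF \<delta>] by eventually_elim (rule bound, auto)
  qed simp
  then show ?thesis
    unfolding hausdorff_outer_def by (intro antisym SUP_least) auto
qed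

lemma hausdorff_dim_range: "hausdorff_dim A \<in> {0..1}"
proof -
  let ?S = "{d. 0 \<le> d \<and> hausdorff_outer d A = 0}"
  have bdd: "bdd_below ?S" by (rule bdd_belowI[of _ 0]) auto
  have mem: "d \<in> ?S" if "d > 1" for d
    using hausdorff_outer_mono[of A UNIV d] hausdorff_outer_UNIV_eq_0[OF that] that by simp
  have "Inf ?S \<le> 1"
  proof (rule field_le_epsilon)
    fix e :: real assume "0 < e"
    then show "Inf ?S \<le> 1 + e" by (intro cInf_lower[OF mem bdd]) simp
  qed
  moreover have "0 \<le> Inf ?S"
  proof (rule cInf_greatest)
    have "(2 :: real) \<in> ?S" by (rule mem) simp
    then show "?S \<noteq> {}" by blast
  qed simp
  ultimately show ?thesis by (simp add: hausdorff_dim_def)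
qed

text \<open>
  The set $[0,1]\times[0,+\infty]$ with its lexicographic order. It is a separate type because
  the library already gives pairs the product order and the product topology.
\<close>

typedef dim_mass = "{0..1::real} \<times> (UNIV :: ennreal set)"
  morphisms pair_of Dim_mass
  by (rule exI[of _ "(0, 0)"]) simp

definition dim_of :: "dim_mass \<Rightarrow> real" where "dim_of h = fst (pair_of h)"
definition mass_of :: "dim_mass \<Rightarrow> ennreal" where "mass_of h = snd (pair_of h)"

lemma dim_of_range: "0 \<le> dim_of h" "dim_of h \<le> 1"
  using pair_of[of h] by (auto simp: dim_of_def)

lemma dim_of_Dim_mass [simp]: "0 \<le> d \<Longrightarrow> d \<le> 1 \<Longrightarrow> dim_of (Dim_mass (d, m)) = d"
  and mass_of_Dim_mass [simp]: "0 \<le> d \<Longrightarrow> d \<le> 1 \<Longrightarrow> mass_of (Dim_mass (d, m)) = m"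
  by (simp_all add: dim_of_def mass_of_def Dim_mass_inverse)

lemma dim_mass_eqI: "dim_of g = dim_of h \<Longrightarrow> mass_of g = mass_of h \<Longrightarrow> g = h"
  unfolding dim_of_def mass_of_def by (metis prod_eq_iff pair_of_inject)

instantiation dim_mass :: linorder
begin

definition less_eq_dim_mass :: "dim_mass \<Rightarrow> dim_mass \<Rightarrow> bool" where
  "g \<le> h \<longleftrightarrow> dim_of g < dim_of h \<or> (dim_of g = dim_of h \<and> mass_of g \<le> mass_of h)"

definition less_dim_mass :: "dim_mass \<Rightarrow> dim_mass \<Rightarrow> bool" where
  "g < h \<longleftrightarrow> dim_of g < dim_of h \<or> (dim_of g = dim_of h \<and> mass_of g < mass_of h)"

instance
  by standard
    (auto simp: less_eq_dim_mass_def less_dim_mass_def intro: dim_mass_eqI)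

end

instantiation dim_mass :: complete_linorder
begin

definition inf_dim_mass :: "dim_mass \<Rightarrow> dim_mass \<Rightarrow> dim_mass" where "inf_dim_mass = min"
definition sup_dim_mass :: "dim_mass \<Rightarrow> dim_mass \<Rightarrow> dim_mass" where "sup_dim_mass = max"
definition bot_dim_mass :: dim_mass where "bot_dim_mass = Dim_mass (0, 0)"
definition top_dim_mass :: dim_mass where "top_dim_mass = Dim_mass (1, top)"

text \<open>
  The second component ranges over the masses at the extremal dimension; if that dimension
  is not attained the set of these masses is empty, giving \<open>top\<close> for the infimum and 0 for
  the supremum.
\<close>

definition Inf_dim_mass :: "dim_mass set \<Rightarrow> dim_mass" where
  "Inf A = (if A = {} then top else
     (let d = Inf (dim_of ` A) in Dim_mass (d, Inf (mass_of ` {h\<in>A. dim_of h = d}))))"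

definition Sup_dim_mass :: "dim_mass set \<Rightarrow> dim_mass" where
  "Sup A = (if A = {} then bot else
     (let d = Sup (dim_of ` A) in Dim_mass (d, Sup (mass_of ` {h\<in>A. dim_of h = d}))))"

instance
proof
  have bb: "bdd_below (dim_of ` A)" and ba: "bdd_above (dim_of ` A)" for A
    using dim_of_range by (auto intro!: bdd_belowI[of _ 0] bdd_aboveI[of _ 1])
  have I: "0 \<le> Inf (dim_of ` A)" "Inf (dim_of ` A) \<le> 1"
    and S: "0 \<le> Sup (dim_of ` A)" "Sup (dim_of ` A) \<le> 1" if ne: "A \<noteq> {}" for A
  proof -
    obtain a where a: "a \<in> A" using ne by blast
    show "0 \<le> Inf (dim_of ` A)" "Sup (dim_of ` A) \<le> 1"
      using ne dim_of_range by (auto intro: cINF_greatest cSUP_least)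
    show "Inf (dim_of ` A) \<le> 1"
      by (rule order_trans[OF cINF_lower[OF bb a] dim_of_range(2)])
    show "0 \<le> Sup (dim_of ` A)"
      by (rule order_trans[OF dim_of_range(1) cSUP_upper[OF a ba]])
  qed
  show "Inf A \<le> x" if "x \<in> A" for x :: dim_mass and A
  proof -
    have ne: "A \<noteq> {}" using that by blast
    have "Inf (dim_of ` A) \<le> dim_of x" by (rule cINF_lower[OF bb that])
    then show ?thesis
      using ne that I[OF ne]
      by (auto simp: Inf_dim_mass_def Let_def less_eq_dim_mass_def intro!: Inf_lower)
  qed
  show "x \<le> Sup A" if "x \<in> A" for x :: dim_mass and A
  proof -
    have ne: "A \<noteq> {}" using that by blast
    have "dim_of x \<le> Sup (dim_of ` A)" by (rule cSUP_upper[OF that ba])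
    then show ?thesis
      using ne that S[OF ne]
      by (auto simp: Sup_dim_mass_def Let_def less_eq_dim_mass_def intro!: Sup_upper)
  qed
  show "z \<le> Inf A" if z: "\<And>x. x \<in> A \<Longrightarrow> z \<le> x" for z :: dim_mass and A
  proof (cases "A = {}")
    case True
    then show ?thesis
      using dim_of_range(2)[of z]
      by (auto simp: Inf_dim_mass_def top_dim_mass_def less_eq_dim_mass_def)
  next
    case False
    have "dim_of z \<le> Inf (dim_of ` A)"
      using False by (rule cINF_greatest) (use z less_eq_dim_mass_def in \<open>fastforce\<close>)
    moreover have "mass_of z \<le> Inf (mass_of ` {h\<in>A. dim_of h = Inf (dim_of ` A)})" if "dim_of z = Inf (dim_of ` A)"
      using that by (intro INF_greatest) (use z less_eq_dim_mass_def in \<open>fastforce\<close>)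
    ultimately show ?thesis
      using False I[OF False] by (auto simp: Inf_dim_mass_def Let_def less_eq_dim_mass_def)
  qed
  show "Sup A \<le> z" if z: "\<And>x. x \<in> A \<Longrightarrow> x \<le> z" for z :: dim_mass and A
  proof (cases "A = {}")
    case True
    then show ?thesis
      using dim_of_range(1)[of z]
      by (auto simp: Sup_dim_mass_def bot_dim_mass_def less_eq_dim_mass_def)
  next
    case False
    have "Sup (dim_of ` A) \<le> dim_of z"
      using False by (rule cSUP_least) (use z less_eq_dim_mass_def in \<open>fastforce\<close>)
    moreover have "Sup (mass_of ` {h\<in>A. dim_of h = Sup (dim_of ` A)}) \<le> mass_of z" if "dim_of z = Sup (dim_of ` A)"
      using that by (intro SUP_least) (use z less_eq_dim_mass_def in \<open>fastforce\<close>)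
    ultimately show ?thesis
      using False S[OF False] by (auto simp: Sup_dim_mass_def Let_def less_eq_dim_mass_def)
  qed
qed (auto simp: inf_dim_mass_def sup_dim_mass_def Inf_dim_mass_def Sup_dim_mass_def)

end

instantiation dim_mass :: linorder_topology
begin

definition open_dim_mass :: "dim_mass set \<Rightarrow> bool" where
  "open_dim_mass = generate_topology (range lessThan \<union> range greaterThan)"

instance
  by standard (rule open_dim_mass_def)

end

lemma lim_INF_dim_mass:
  fixes h :: "nat \<Rightarrow> dim_mass"
  shows "(\<lambda>n. INF k\<in>{n..}. h k) \<longlonglongrightarrow> lim (\<lambda>n. INF k\<in>{n..}. h k)"
    and "lim (\<lambda>n. INF k\<in>{n..}. h k) = liminf h"
proof -
  have "incseq (\<lambda>n. INF k\<in>{n..}. h k)"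
    by (auto simp: incseq_def intro!: INF_superset_mono)
  then have *: "(\<lambda>n. INF k\<in>{n..}. h k) \<longlonglongrightarrow> liminf h"
    unfolding liminf_SUP_INF by (rule LIMSEQ_SUP)
  then show "lim (\<lambda>n. INF k\<in>{n..}. h k) = liminf h"
    by (rule limI)
  with * show "(\<lambda>n. INF k\<in>{n..}. h k) \<longlonglongrightarrow> lim (\<lambda>n. INF k\<in>{n..}. h k)"
    by simp
qed

text \<open>
  The Hausdorff-integral of a non-negative function over \<open>K\<close>; only the values of \<open>f\<close> on \<open>K\<close>
  matter. For non-negative \<open>f\<close> the mass is the (possibly infinite) Lebesgue integral with
  respect to the Hausdorff measure of the dimension of the support.
\<close>

definition nonzero_set :: "real set \<Rightarrow> (real \<Rightarrow> real) \<Rightarrow> real set" where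
  "nonzero_set K f = {x\<in>K. f x \<noteq> 0}"

definition hausdorff_integral :: "real set \<Rightarrow> (real \<Rightarrow> real) \<Rightarrow> dim_mass" where
  "hausdorff_integral K f =
     (let D = nonzero_set K f; d = hausdorff_dim D
      in Dim_mass (d, \<integral>\<^sup>+x\<in>D. ennreal (f x) \<partial>hausdorff_measure d))"

end

theory Submission
  imports Defs
begin

text \<open>
  The statement is Fatou's lemma in the lexicographic order, and it splits into a statement
  about dimensions and one about masses.

  Write \<open>D\<close> for the set where \<open>f\<close> does not vanish, \<open>D\<^sub>k\<close> for the corresponding set of
  \<open>fs k\<close>, and \<open>d\<close> for the dimension of \<open>D\<close>. A point with \<open>f x \<noteq> 0\<close> lies in all but finitely
  many \<open>D\<^sub>k\<close>, so \<open>D\<close> is contained in the increasing union of the sets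
  \<open>E\<^sub>n = (\<Inter>k\<ge>n. D\<^sub>k)\<close>, and each \<open>E\<^sub>n\<close> is contained in every \<open>D\<^sub>k\<close> with \<open>k \<ge> n\<close>.

  The claim means that every \<open>y\<close> strictly below the Hausdorff-integral of \<open>f\<close> is eventually
  strictly below that of \<open>fs k\<close>. If the dimension of \<open>y\<close> is less than \<open>d\<close>, then countable
  stability of the dimension (\<open>hausdorff_dim_UN_le\<close>) gives some \<open>E\<^sub>n\<close> of dimension greater
  than that of \<open>y\<close>, and all later \<open>D\<^sub>k\<close> inherit this. Otherwise \<open>y\<close> has dimension \<open>d\<close> and
  the mass of \<open>f\<close> is positive. Some \<open>E\<^sub>n\<close> then has dimension at least \<open>d\<close>, because sets of
  dimension below \<open>d\<close> are \<open>\<mu>\<^sup>d\<close>-null and countably many of them could not carry the positive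
  mass; this keeps the dimension of \<open>D\<^sub>k\<close> from dropping below \<open>d\<close> when \<open>k \<ge> n\<close>. The ordinary
  lemma of Fatou for the single measure \<open>\<mu>\<^sup>d\<close> (\<open>set_nn_integral_le_liminf\<close>) bounds the mass
  of \<open>f\<close> by the lower limit of the \<open>\<mu>\<^sup>d\<close>-integrals of \<open>fs k\<close>. These integrals are the masses
  of \<open>fs k\<close> at those \<open>k\<close> where \<open>D\<^sub>k\<close> has dimension exactly \<open>d\<close>; at the other \<open>k \<ge> n\<close> the
  dimension alone decides.

  The dimension is defined by the outer measures and the mass by \<open>\<mu>\<^sup>d\<close>. The link between them
  is that the outer measure dominates \<open>\<mu>\<^sup>d\<close> (\<open>emeasure_hausdorff_measure_le\<close>), so that its
  null sets are also \<open>\<mu>\<^sup>d\<close>-null.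
\<close>

section \<open>Hausdorff outer measures and dimension\<close>

text \<open>
  In a cover by sets of diameter at most 1 a larger exponent never increases a gauge, and
  small \<open>\<delta>\<close> are the ones that matter for the supremum.
\<close>

lemma hausdorff_outer_antimono_exponent:
  assumes "0 \<le> c" "c \<le> d"
  shows "hausdorff_outer d A \<le> hausdorff_outer c A"
  unfolding hausdorff_outer_def
proof (rule SUP_mono)
  fix \<delta> :: real assume \<delta>: "\<delta> \<in> {0<..}"
  have gauge: "hausdorff_gauge d V \<le> hausdorff_gauge c V"
    if "bounded V" "diameter V \<le> 1" for V
  proof -
    have "0 \<le> diameter V" using that(1) by (rule diameter_ge_0)
    then have "diameter V powr d \<le> diameter V powr c" "diameter V powr d \<le> 1"
      using that assms by (auto intro: powr_mono' powr_le1)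
    then show ?thesis
      using assms by (auto simp: hausdorff_gauge_def intro: ennreal_leI)
  qed
  have "(INF U\<in>delta_covers \<delta> A. \<Sum>i. hausdorff_gauge d (U i))
      \<le> (INF U\<in>delta_covers (min \<delta> 1) A. \<Sum>i. hausdorff_gauge c (U i))"
    by (rule INF_mono, rule bexI, rule suminf_le)
       (auto simp: delta_covers_def intro!: gauge)
  then show "\<exists>\<delta>'\<in>{0<..}. (INF U\<in>delta_covers \<delta> A. \<Sum>i. hausdorff_gauge d (U i))
      \<le> (INF U\<in>delta_covers \<delta>' A. \<Sum>i. hausdorff_gauge c (U i))"
    using \<delta> by (intro bexI[of _ "min \<delta> 1"]) auto
qed

text \<open>
  Nearly optimal covers of the sets \<open>A n\<close>, the \<open>n\<close>-th one within \<open>\<epsilon> / 2\<^sup>n\<^sup>+\<^sup>1\<close> of the infimum, are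
  merged into one cover of the union by enumerating the pairs of indices.
\<close>

lemma hausdorff_outer_countably_subadditive:
  "hausdorff_outer d (\<Union>n. A n) \<le> (\<Sum>n. hausdorff_outer d (A n))"
proof -
  define pre where "pre \<delta> B = (INF U\<in>delta_covers \<delta> B. \<Sum>i. hausdorff_gauge d (U i))" for \<delta> B
  have pre_le: "pre \<delta> B \<le> hausdorff_outer d B" if "0 < \<delta>" for \<delta> B
    unfolding pre_def hausdorff_outer_def using that by (intro SUP_upper) auto
  have sub: "pre \<delta> (\<Union>n. A n) \<le> (\<Sum>n. pre \<delta> (A n))" for \<delta>
  proof (rule ennreal_le_epsilon)
    fix e :: real assume fin: "(\<Sum>n. pre \<delta> (A n)) < top" and e: "0 < e"
    have "pre \<delta> (A n) \<noteq> \<infinity>" for n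
      using fin ennreal_suminf_lessD[of "\<lambda>n. pre \<delta> (A n)" top n] by auto
    then have "\<exists>U\<in>delta_covers \<delta> (A n).
        (\<Sum>i. hausdorff_gauge d (U i)) < pre \<delta> (A n) + ennreal (e * (1/2)^Suc n)" for n
      using e by (intro INF_approx_ennreal pre_def) auto
    then obtain U where U: "\<And>n. U n \<in> delta_covers \<delta> (A n)"
      and Ule: "\<And>n. (\<Sum>i. hausdorff_gauge d (U n i)) < pre \<delta> (A n) + ennreal (e * (1/2)^Suc n)"
      by metis
    define V where "V j = (case prod_decode j of (n, i) \<Rightarrow> U n i)" for j
    have "V \<in> delta_covers \<delta> (\<Union>n. A n)"
    proof -
      have "x \<in> (\<Union>j. V j)" if x: "x \<in> A n" for x n
      proof -
        obtain i where "x \<in> U n i" using U[of n] x by (auto simp: delta_covers_def)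
        then have "x \<in> V (prod_encode (n, i))" by (simp add: V_def)
        then show ?thesis by blast
      qed
      then show ?thesis
        using U by (auto simp: delta_covers_def V_def split: prod.split)
    qed
    then have "pre \<delta> (\<Union>n. A n) \<le> (\<Sum>j. hausdorff_gauge d (V j))"
      unfolding pre_def by (rule INF_lower)
    also have "\<dots> = (\<Sum>j. (\<lambda>(n, i). hausdorff_gauge d (U n i)) (prod_decode j))"
      by (simp add: V_def case_prod_beta)
    also have "\<dots> = (\<Sum>n. \<Sum>i. hausdorff_gauge d (U n i))"
      by (rule suminf_ennreal_2dimen) simp
    also have "\<dots> \<le> (\<Sum>n. pre \<delta> (A n) + ennreal (e * (1/2)^Suc n))"
      using Ule by (intro suminf_le) (auto intro: less_imp_le)
    also have "\<dots> = (\<Sum>n. pre \<delta> (A n)) + (\<Sum>n. ennreal (e * (1/2)^Suc n))"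
      by (rule suminf_add[symmetric]) auto
    also have "(\<Sum>n. ennreal (e * (1/2)^Suc n)) = ennreal e"
      using sums_mult[OF power_half_series, of e] e by (intro suminf_ennreal_eq) auto
    finally show "pre \<delta> (\<Union>n. A n) \<le> (\<Sum>n. pre \<delta> (A n)) + ennreal e" .
  qed
  have "pre \<delta> (\<Union>n. A n) \<le> (\<Sum>n. hausdorff_outer d (A n))" if "0 < \<delta>" for \<delta>
    by (rule order_trans[OF sub]) (use pre_le[OF that] in \<open>intro suminf_le\<close>, auto)
  then show ?thesis
    unfolding hausdorff_outer_def[of d "\<Union>n. A n"] pre_def by (intro SUP_least) auto
qed

lemma hausdorff_outer_UN_eq_0:
  fixes A :: "nat \<Rightarrow> real set"
  assumes "\<And>n. hausdorff_outer d (A n) = 0"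
  shows "hausdorff_outer d (\<Union>n. A n) = 0"
  using hausdorff_outer_countably_subadditive[of d A] assms by simp

lemma hausdorff_dim_leI:
  assumes "0 \<le> d" "hausdorff_outer d A = 0"
  shows "hausdorff_dim A \<le> d"
  unfolding hausdorff_dim_def using assms by (intro cInf_lower bdd_belowI[of _ 0]) auto

lemma hausdorff_outer_eq_0_if_dim_less:
  assumes "hausdorff_dim A < d"
  shows "hausdorff_outer d A = 0"
proof -
  let ?S = "{c. 0 \<le> c \<and> hausdorff_outer c A = 0}"
  have "hausdorff_outer 2 A = 0"
    using hausdorff_outer_mono[of A UNIV 2] hausdorff_outer_UNIV_eq_0[of 2] by simp
  then have "2 \<in> ?S" by simp
  then have "?S \<noteq> {}" by blast
  moreover have "Inf ?S < d" using assms by (simp add: hausdorff_dim_def)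
  ultimately have "\<exists>c\<in>?S. c < d" by (rule cInf_lessD)
  then obtain c where "c \<in> ?S" "c < d" by blast
  then show ?thesis
    using hausdorff_outer_antimono_exponent[of c d A] by simp
qed

lemma hausdorff_dim_le_iff:
  assumes "0 \<le> d"
  shows "hausdorff_dim A \<le> d \<longleftrightarrow> (\<forall>e>d. hausdorff_outer e A = 0)"
proof
  assume null: "\<forall>e>d. hausdorff_outer e A = 0"
  show "hausdorff_dim A \<le> d"
    by (rule dense_ge, rule hausdorff_dim_leI) (use assms null in auto)
qed (auto intro: hausdorff_outer_eq_0_if_dim_less)

lemma hausdorff_dim_mono:
  assumes "A \<subseteq> B"
  shows "hausdorff_dim A \<le> hausdorff_dim B"
proof -
  have "0 \<le> hausdorff_dim B" using hausdorff_dim_range[of B] by simp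
  moreover have "hausdorff_outer e A = 0" if "hausdorff_dim B < e" for e
    using hausdorff_outer_mono[OF assms, of e] hausdorff_outer_eq_0_if_dim_less[OF that] by simp
  ultimately show ?thesis by (simp add: hausdorff_dim_le_iff)
qed

lemma hausdorff_dim_UN_le:
  fixes A :: "nat \<Rightarrow> real set"
  assumes "0 \<le> d" "\<And>n. hausdorff_dim (A n) \<le> d"
  shows "hausdorff_dim (\<Union>n. A n) \<le> d"
  using assms by (auto simp: hausdorff_dim_le_iff intro: hausdorff_outer_UN_eq_0)

section \<open>Hausdorff measures\<close>

lemma sets_hausdorff_measure [measurable_cong, simp]: "sets (hausdorff_measure d) = sets borel"
  unfolding hausdorff_measure_def using sets.sigma_sets_eq[of "borel :: real measure"] by simp

lemma space_hausdorff_measure [simp]: "space (hausdorff_measure d) = UNIV"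
  using sets_eq_imp_space_eq[OF sets_hausdorff_measure] by simp

text \<open>
  By definition \<^const>\<open>measure_of\<close> agrees with the given set function if that is a measure, and
  is zero otherwise; either way it stays below the set function.
\<close>

lemma emeasure_hausdorff_measure_le: "emeasure (hausdorff_measure d) A \<le> hausdorff_outer d A"
  unfolding hausdorff_measure_def emeasure_measure_of_conv by auto

section \<open>Fatou's lemma for the Hausdorff-integral\<close>

lemma nonzero_set_subset_UN_INT:
  assumes "\<And>x. x \<in> K \<Longrightarrow> (\<lambda>n. fs n x) \<longlonglongrightarrow> f x"
  shows "nonzero_set K f \<subseteq> (\<Union>n. \<Inter>k\<in>{n..}. nonzero_set K (fs k))"
proof
  fix x assume "x \<in> nonzero_set K f"
  then have x: "x \<in> K" "f x \<noteq> 0" by (auto simp: nonzero_set_def)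
  have "\<forall>\<^sub>F n in sequentially. fs n x \<noteq> 0"
    using tendsto_imp_eventually_ne[OF assms[OF x(1)] x(2)] .
  then show "x \<in> (\<Union>n. \<Inter>k\<in>{n..}. nonzero_set K (fs k))"
    using x(1) by (auto simp: nonzero_set_def eventually_sequentially)
qed

lemma borel_nonzero_set:
  assumes "K \<in> sets borel" "g \<in> borel_measurable (restrict_space borel K)"
  shows "nonzero_set K g \<in> sets borel"
proof -
  have "{x \<in> space (restrict_space borel K). g x \<noteq> 0} \<in> sets (restrict_space borel K)"
    using assms(2) by measurable
  then show ?thesis
    using assms(1) by (simp add: nonzero_set_def space_restrict_space sets_restrict_space_iff)
qed

text \<open>
  The supports vary with the function; integrating over the common domain \<open>K\<close> instead is what
  makes a sequence of masses accessible to Fatou's lemma.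
\<close>

lemma set_nn_integral_nonzero_set:
  "(\<integral>\<^sup>+x\<in>nonzero_set K g. ennreal (g x) \<partial>M) = (\<integral>\<^sup>+x\<in>K. ennreal (g x) \<partial>M)"
  by (intro nn_integral_cong) (auto simp: nonzero_set_def indicator_def)

lemma set_nn_integral_le_liminf:
  assumes K: "K \<in> sets M"
    and meas: "\<And>n. fs n \<in> borel_measurable (restrict_space M K)"
    and lim: "\<And>x. x \<in> K \<Longrightarrow> (\<lambda>n. fs n x) \<longlonglongrightarrow> f x"
  shows "(\<integral>\<^sup>+x\<in>K. ennreal (f x) \<partial>M) \<le> liminf (\<lambda>n. \<integral>\<^sup>+x\<in>K. ennreal (fs n x) \<partial>M)"
proof -
  have "(\<integral>\<^sup>+x\<in>K. ennreal (f x) \<partial>M)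
      = (\<integral>\<^sup>+x. liminf (\<lambda>n. ennreal (fs n x) * indicator K x) \<partial>M)"
  proof (rule nn_integral_cong)
    fix x
    have "(\<lambda>n. ennreal (fs n x) * indicator K x) \<longlonglongrightarrow> ennreal (f x) * indicator K x"
      using lim[of x] by (cases "x \<in> K") (auto intro: tendsto_ennrealI)
    then show "ennreal (f x) * indicator K x = liminf (\<lambda>n. ennreal (fs n x) * indicator K x)"
      using lim_imp_Liminf[OF sequentially_bot] by metis
  qed
  also have "\<dots> \<le> liminf (\<lambda>n. \<integral>\<^sup>+x\<in>K. ennreal (fs n x) \<partial>M)"
  proof (rule nn_integral_liminf)
    fix n
    have "(\<lambda>x. ennreal (fs n x)) \<in> borel_measurable (restrict_space M K)"
      using meas by measurable
    then show "(\<lambda>x. ennreal (fs n x) * indicator K x) \<in> borel_measurable M"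
      using K by (subst (asm) borel_measurable_restrict_space_iff_ennreal) auto
  qed
  finally show ?thesis .
qed

lemma dim_of_hausdorff_integral:
  "dim_of (hausdorff_integral K g) = hausdorff_dim (nonzero_set K g)"
  and mass_of_hausdorff_integral:
  "mass_of (hausdorff_integral K g)
     = (\<integral>\<^sup>+x\<in>K. ennreal (g x) \<partial>hausdorff_measure (hausdorff_dim (nonzero_set K g)))"
  using hausdorff_dim_range[of "nonzero_set K g"]
  by (auto simp: hausdorff_integral_def Let_def set_nn_integral_nonzero_set)

theorem theorem2p42:
  fixes K :: "real set" and f :: "real \<Rightarrow> real" and fs :: "nat \<Rightarrow> real \<Rightarrow> real"
  assumes "K \<in> sets borel"
    and "\<And>n. fs n \<in> borel_measurable (restrict_space borel K)"
    and "\<And>n x. x \<in> K \<Longrightarrow> 0 \<le> fs n x"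
    and "\<And>x. x \<in> K \<Longrightarrow> (\<lambda>n. fs n x) \<longlonglongrightarrow> f x"
  shows "hausdorff_integral K f \<le> lim (\<lambda>n. INF k\<in>{n..}. hausdorff_integral K (fs k))"
proof -
  define D where "D = nonzero_set K f"
  define E where "E n = (\<Inter>k\<in>{n..}. nonzero_set K (fs k))" for n
  define d where "d = hausdorff_dim D"
  have D_sub: "D \<subseteq> (\<Union>n. E n)"
    unfolding D_def E_def using assms(4) by (rule nonzero_set_subset_UN_INT)
  have E_borel: "E n \<in> sets borel" for n
    unfolding E_def using assms(1,2) by (intro sets.countable_INT'' borel_nonzero_set) auto
  have E_dim: "hausdorff_dim (E n) \<le> hausdorff_dim (nonzero_set K (fs k))" if "n \<le> k" for n k
    using that by (intro hausdorff_dim_mono) (auto simp: E_def)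
  have "\<forall>\<^sub>F k in sequentially. y < hausdorff_integral K (fs k)"
    if y: "y < hausdorff_integral K f" for y
  proof (cases "dim_of y < d")
    case True
    have "\<exists>n. dim_of y < hausdorff_dim (E n)"
    proof (rule ccontr)
      assume "\<not> ?thesis"
      then have "hausdorff_dim (\<Union>n. E n) \<le> dim_of y"
        by (intro hausdorff_dim_UN_le dim_of_range) (auto simp: not_less)
      then show False
        using hausdorff_dim_mono[OF D_sub] True by (simp add: d_def)
    qed
    then obtain n where n: "dim_of y < hausdorff_dim (E n)" ..
    then show ?thesis
      using E_dim[of n] unfolding eventually_sequentially
      by (intro exI[of _ n])
         (auto simp: less_dim_mass_def dim_of_hausdorff_integral intro: less_le_trans)
  next
    case False
    let ?mass = "\<lambda>g. \<integral>\<^sup>+x\<in>K. ennreal (g x) \<partial>hausdorff_measure d"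
    have y_dim: "dim_of y = d" and y_mass: "mass_of y < ?mass f"
      using y False
      by (auto simp: less_dim_mass_def dim_of_hausdorff_integral mass_of_hausdorff_integral
          d_def D_def)
    have "\<exists>n. d \<le> hausdorff_dim (E n)"
    proof (rule ccontr)
      assume "\<not> ?thesis"
      then have "hausdorff_outer d (\<Union>n. E n) = 0"
        by (intro hausdorff_outer_UN_eq_0 hausdorff_outer_eq_0_if_dim_less) (auto simp: not_le)
      then have "emeasure (hausdorff_measure d) (\<Union>n. E n) = 0"
        using emeasure_hausdorff_measure_le[of d "\<Union>n. E n"] by simp
      then have "(\<Union>n. E n) \<in> null_sets (hausdorff_measure d)"
        using E_borel by (auto intro!: null_setsI)
      then have "AE x in hausdorff_measure d. x \<notin> (\<Union>n. E n)"
        by (rule AE_not_in)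
      then have "AE x in hausdorff_measure d. ennreal (f x) * indicator K x = 0"
        by eventually_elim
          (use D_sub in \<open>auto simp: D_def nonzero_set_def indicator_def\<close>)
      then have "?mass f = 0"
        using nn_integral_cong_AE by fastforce
      then show False using y_mass by simp
    qed
    then obtain n where n: "d \<le> hausdorff_dim (E n)" ..
    have "?mass f \<le> liminf (\<lambda>k. ?mass (fs k))"
    proof (rule set_nn_integral_le_liminf)
      show "fs k \<in> borel_measurable (restrict_space (hausdorff_measure d) K)" for k
        using assms(2)[of k] by (simp cong: measurable_cong_sets sets_restrict_space_cong)
    qed (use assms in auto)
    then have "\<forall>\<^sub>F k in sequentially. mass_of y < ?mass (fs k)"
      using y_mass by (auto simp: le_Liminf_iff)
    moreover have "\<forall>\<^sub>F k in sequentially. d \<le> hausdorff_dim (nonzero_set K (fs k))"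
      using eventually_ge_at_top[of n] by eventually_elim (use n E_dim in \<open>blast intro: order_trans\<close>)
    ultimately show ?thesis
    proof eventually_elim
      case (elim k)
      then show ?case
        by (cases "hausdorff_dim (nonzero_set K (fs k)) = d")
           (auto simp: less_dim_mass_def y_dim dim_of_hausdorff_integral
              mass_of_hausdorff_integral)
    qed
  qed
  then show ?thesis
    unfolding lim_INF_dim_mass(2) by (simp add: le_Liminf_iff)
qed

end
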